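(* Let $G$ be a connected $\{C_{3},C_{4}\}$-free graph with minimum degree $\delta(G)\geq 3$. Then the following hold. (i) If $\mathrm{diam}(G)\geq 20$, then $T_{8}^{(1)}\prec G$. (ii) If $\mathrm{diam}(G)\geq 16$, then $T_{8}^{(2)}\prec G$. (iii) If $\mathrm{diam}(G)\geq 12$, then $T_{9}\prec G$.
   Context: All graphs are finite, simple and undirected. $C_n$ is the cycle of order $n$. $H\prec G$ means that $G$ contains an induced subgraph isomorphic to $H$; a graph is $\{C_3,C_4\}$-free if it contains neither $C_3$ nor $C_4$ as an induced subgraph. $\mathrm{diam}(G)$ is the maximum distance between two vertices of $G$. For $n\geq 4$, $T_n$ is the graph obtained from a path $u_1u_2\cdots u_n$ of order $n$ by adding two vertices $v_3,v_3'$ and the edges $u_3v_3,\ v_3v_3'$. $T_8^{(1)}$ is the graph obtained from $T_8$ by adding two vertices $w_5,w_6$ and the edges $u_5w_5,\ u_6w_6$. $T_8^{(2)}$ is the graph obtained from $T_8$ by adding one vertex $w_4$ and the edge $u_4w_4$. *)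

theory Defs
  imports "Graph_Theory.Graph_Theory"
begin

text \<open>
  A finite simple undirected graph is a \<^locale>\<open>pair_graph\<close>: a finite vertex set together with a
  symmetric irreflexive set of ordered pairs.  Every undirected edge is represented by both of its
  orientations, so the degree of a vertex is its out-degree, and
  \<^const>\<open>Digraph_Component.connected\<close> is ordinary connectedness of a nonempty graph.
\<close>

text \<open>With unit arc weights \<^const>\<open>wf_digraph.\<mu>\<close> is the length of a shortest walk.\<close>

definition gdist :: "'a pair_pre_digraph \<Rightarrow> 'a \<Rightarrow> 'a \<Rightarrow> ereal" where
  "gdist G u v = wf_digraph.\<mu> (with_proj G) (\<lambda>_. 1) u v"

definition diam :: "'a pair_pre_digraph \<Rightarrow> ereal" where
  "diam G = Max {gdist G u v | u v. u \<in> pverts G \<and> v \<in> pverts G}"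

definition min_degree :: "'a pair_pre_digraph \<Rightarrow> nat" where
  "min_degree G = Min (out_degree (with_proj G) ` pverts G)"

definition induced_in :: "'b pair_pre_digraph \<Rightarrow> 'a pair_pre_digraph \<Rightarrow> bool" (infix \<open>\<prec>\<close> 50) where
  "H \<prec> G \<longleftrightarrow> (\<exists>K. induced_subgraph K (with_proj G) \<and> digraph_iso (with_proj H) K)"

text \<open>Add the vertices \<open>A\<close> and, for each pair in \<open>E\<close>, the undirected edge joining its components.\<close>

definition extend :: "'a pair_pre_digraph \<Rightarrow> 'a set \<Rightarrow> ('a \<times> 'a) set \<Rightarrow> 'a pair_pre_digraph" where
  "extend G A E = \<lparr> pverts = pverts G \<union> A, parcs = parcs G \<union> E \<union> E\<inverse> \<rparr>"

text \<open>The cycle of order \<open>n\<close> on \<open>0, \<dots>, n - 1\<close>; meaningful for \<open>n \<ge> 3\<close> only.\<close>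

definition cycle_graph :: "nat \<Rightarrow> nat pair_pre_digraph" where
  "cycle_graph n =
     extend \<lparr> pverts = {}, parcs = {} \<rparr> {..<n} {(i, Suc i mod n) | i. i < n}"

text \<open>
  \<open>u i\<close>, \<open>v i\<close>, \<open>v' i\<close>, \<open>w i\<close> of the mathematical text are \<open>U i\<close>, \<open>V i\<close>, \<open>V' i\<close>, \<open>W i\<close>.
\<close>

datatype vertex = U nat | V nat | V' nat | W nat

definition path_graph :: "nat \<Rightarrow> vertex pair_pre_digraph" where
  "path_graph n =
     extend \<lparr> pverts = {}, parcs = {} \<rparr> (U ` {1..n}) {(U i, U (Suc i)) | i. 1 \<le> i \<and> i < n}"

definition T :: "nat \<Rightarrow> vertex pair_pre_digraph" where
  "T n = extend (path_graph n) {V 3, V' 3} {(U 3, V 3), (V 3, V' 3)}"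

definition T8_1 :: "vertex pair_pre_digraph" where
  "T8_1 = extend (T 8) {W 5, W 6} {(U 5, W 5), (U 6, W 6)}"

definition T8_2 :: "vertex pair_pre_digraph" where
  "T8_2 = extend (T 8) {W 4} {(U 4, W 4)}"

lemma pair_graph_extend:
  assumes "pair_graph G" "finite A" "E \<subseteq> (pverts G \<union> A) \<times> (pverts G \<union> A)"
    and "\<And>x. (x, x) \<notin> E"
  shows "pair_graph (extend G A E)"
proof -
  interpret pair_graph G by fact
  have "finite E"
    using assms(2,3) pair_finite_verts by (meson finite_SigmaI finite_UnI finite_subset)
  then show ?thesis
    using assms pair_finite_verts pair_finite_arcs arcs_symmetric
    by unfold_locales
      (auto simp: extend_def symmetric_def sym_def
        dest: in_arcsD1 in_arcsD2 no_loops')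
qed

lemma pair_graph_empty: "pair_graph \<lparr> pverts = {}, parcs = {} \<rparr>"
  by unfold_locales (auto simp: symmetric_def sym_def)

lemma pair_graph_cycle_graph: "3 \<le> n \<Longrightarrow> pair_graph (cycle_graph n)"
  unfolding cycle_graph_def
  by (rule pair_graph_extend[OF pair_graph_empty]) (auto simp: mod_Suc intro!: gr0I split: if_splits)

lemma pair_graph_path_graph: "pair_graph (path_graph n)"
  unfolding path_graph_def by (rule pair_graph_extend[OF pair_graph_empty]) auto

lemma pair_graph_T: "3 \<le> n \<Longrightarrow> pair_graph (T n)"
  unfolding T_def
  by (rule pair_graph_extend[OF pair_graph_path_graph]) (auto simp: path_graph_def extend_def)

lemma pair_graph_T8_1: "pair_graph T8_1"
  unfolding T8_1_def
  by (rule pair_graph_extend[OF pair_graph_T]) (auto simp: T_def path_graph_def extend_def)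

lemma pair_graph_T8_2: "pair_graph T8_2"
  unfolding T8_2_def
  by (rule pair_graph_extend[OF pair_graph_T]) (auto simp: T_def path_graph_def extend_def)

lemma induced_in_iff:
  assumes "pair_graph G" "pair_graph H"
  shows "H \<prec> G \<longleftrightarrow> (\<exists>f. inj_on f (pverts H) \<and> f ` pverts H \<subseteq> pverts G \<and>
    (\<forall>x \<in> pverts H. \<forall>y \<in> pverts H. (f x, f y) \<in> parcs G \<longleftrightarrow> (x, y) \<in> parcs H))"
    (is "_ \<longleftrightarrow> (\<exists>f. ?emb f)")
proof
  interpret G: pair_graph G by fact
  interpret H: pair_graph H by fact
  {
    assume "H \<prec> G"
    then obtain K h where K: "induced_subgraph K (with_proj G)"
      and h: "pre_digraph.digraph_isomorphism (with_proj H) h" "K = app_iso h (with_proj H)"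
      unfolding induced_in_def digraph_iso_def by blast
    have tl: "tail K = fst" "head K = snd"
      using K by (auto simp: induced_subgraph_def subgraph_def compatible_def)
    have vK: "verts K = iso_verts h ` pverts H" "arcs K = iso_arcs h ` parcs H"
      using h(2) by auto
    have a: "iso_arcs h e = (iso_verts h (fst e), iso_verts h (snd e))" if "e \<in> parcs H" for e
      using h that tl unfolding pre_digraph.digraph_isomorphism_def
      by (auto simp: prod_eq_iff)
    have inj: "inj_on (iso_verts h) (pverts H)"
      using h(1) unfolding pre_digraph.digraph_isomorphism_def by simp
    have aK: "arcs K = {e \<in> parcs G. fst e \<in> verts K \<and> snd e \<in> verts K}"
      using K by (auto simp: induced_subgraph_def tl)
    have "(iso_verts h x, iso_verts h y) \<in> parcs G \<longleftrightarrow> (x, y) \<in> parcs H"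
      if xy: "x \<in> pverts H" "y \<in> pverts H" for x y
    proof
      assume "(iso_verts h x, iso_verts h y) \<in> parcs G"
      then have "(iso_verts h x, iso_verts h y) \<in> iso_arcs h ` parcs H"
        using xy aK vK by auto
      then obtain e where e: "e \<in> parcs H" "iso_verts h x = iso_verts h (fst e)"
          "iso_verts h y = iso_verts h (snd e)"
        using a by (smt (verit) imageE prod.inject)
      then have "x = fst e" "y = snd e"
        using xy inj H.arc_fst_in_verts H.arc_snd_in_verts by (auto dest: inj_onD)
      then show "(x, y) \<in> parcs H" using e by simp
    next
      assume "(x, y) \<in> parcs H"
      then have "iso_arcs h (x, y) \<in> arcs K" using vK by auto
      then show "(iso_verts h x, iso_verts h y) \<in> parcs G"
        using a[OF \<open>(x, y) \<in> parcs H\<close>] aK by auto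
    qed
    moreover have "iso_verts h ` pverts H \<subseteq> pverts G"
      using K vK by (auto simp: induced_subgraph_def subgraph_def)
    ultimately show "\<exists>f. ?emb f" using inj by blast
  }
  {
    assume "\<exists>f. ?emb f"
    then obtain f where f: "?emb f" by blast
    define h where "h = \<lparr> iso_verts = f, iso_arcs = map_prod f f, iso_head = snd, iso_tail = fst \<rparr>"
    have "inj_on (map_prod f f) (parcs H)"
      using f H.in_arcsD1 H.in_arcsD2
      by (intro inj_on_subset[OF map_prod_inj_on[of f "pverts H" f "pverts H"]]) auto
    then have "pre_digraph.digraph_isomorphism (with_proj H) h"
      using f H.wf_digraph_axioms
      unfolding pre_digraph.digraph_isomorphism_def h_def by (auto simp: wf_digraph_def)
    moreover have "arcs (app_iso h (with_proj H)) =
        {e \<in> parcs G. fst e \<in> f ` pverts H \<and> snd e \<in> f ` pverts H}"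
      using f H.in_arcsD1 H.in_arcsD2
      by (force simp: h_def map_prod_def)
    then have "induced_subgraph (app_iso h (with_proj H)) (with_proj G)"
      using f G.wf_digraph_axioms
      by (auto simp: induced_subgraph_def subgraph_def compatible_def h_def wf_digraph_def)
    ultimately show "H \<prec> G"
      unfolding induced_in_def digraph_iso_def by blast
  }
qed

end

theory Submission
  imports Defs
begin

text \<open>
  Choose a geodesic \<open>x\<^sub>0 \<dots> x\<^sub>D\<close> whose length \<open>D\<close> is at least the diameter bound, and let \<open>Y\<^sub>i\<close> be the
  set of neighbours of \<open>x\<^sub>i\<close> off the geodesic. Since \<open>G\<close> has no cycle of length 3 or 4, the sets
  \<open>Y\<^sub>i\<close> are disjoint, edges between \<open>Y\<^sub>i\<close> and \<open>Y\<^sub>j\<close> occur only if \<open>\<bar>i - j\<bar>\<close> is 2 or 3, and a vertex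
  other than \<open>x\<^sub>i\<close> has at most one neighbour in \<open>Y\<^sub>i\<close>. Because the minimum degree is at least 3, \<open>Y\<^sub>i\<close>
  is nonempty for \<open>0 < i < D\<close>, and every \<open>y\<close> in \<open>Y\<^sub>i\<close> has for each \<open>j \<le> D\<close> a neighbour other than
  \<open>x\<^sub>i\<close> outside \<open>Y\<^sub>j\<close>.

  All three trees arise from a segment \<open>x\<^bsub>i-2\<^esub>, x\<^bsub>i-1\<^esub>, \<dots>\<close> of the geodesic by hanging a path \<open>y, z\<close>
  with \<open>y \<in> Y\<^sub>i\<close> on \<open>x\<^sub>i\<close> and, possibly, single vertices of \<open>Y\<^bsub>i+1\<^esub>\<close> or of \<open>Y\<^bsub>i+2\<^esub>\<close> and
  \<open>Y\<^bsub>i+3\<^esub>\<close>. If such a tree is not induced, one of a few unwanted adjacencies must be present.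

  These adjacencies are turned into shortcuts. A walk of length \<open>m\<close> from \<open>Y\<^sub>i\<close> to \<open>Y\<^sub>j\<close> satisfies
  \<open>j - i \<le> m + 2\<close>, as \<open>x\<close> is a geodesic (\<open>Y_Y_walk_bound\<close>); call \<open>j - i - m\<close> its gain, so that the
  gain is at most 2. Every case produces three consecutive walks of positive gain starting in \<open>Y\<^sub>2\<close>,
  which is a contradiction.

  \<^item> Without \<open>T\<^sub>9\<close>, a neighbour of \<open>y \<in> Y\<^sub>i\<close> other than \<open>x\<^sub>i\<close> lies in \<open>Y\<^bsub>i-2\<^esub>\<close>, \<open>Y\<^bsub>i+2\<^esub>\<close> or
    \<open>Y\<^bsub>i+3\<^esub>\<close>. One of them is not in \<open>Y\<^bsub>i-2\<^esub>\<close>, and the edge to it has gain 1 or 2.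
  \<^item> Without \<open>T\<^sub>8\<^sup>(\<^sup>2\<^sup>)\<close>, there is the further possibility that \<open>z\<close> is adjacent to all of \<open>Y\<^bsub>i+1\<^esub>\<close>.
    If moreover \<open>z\<close> had no neighbour on the geodesic, the same would apply to \<open>z\<close> and
    \<open>Y\<^bsub>i+1\<^esub>, Y\<^bsub>i+2\<^esub>, \<dots>\<close>, and the path from \<open>Y\<^sub>i\<close> through \<open>z\<close> to \<open>Y\<^bsub>i+5\<^esub>\<close> would have gain 3. So \<open>z\<close>
    lies in some \<open>Y\<^sub>j\<close>; here \<open>j = i - 3\<close> is impossible, as \<open>Y\<^bsub>i-3\<^esub>\<close> has no edges to \<open>Y\<^bsub>i+1\<^esub>\<close>, and the
    conclusion is the same as for \<open>T\<^sub>9\<close>.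
  \<^item> Without \<open>T\<^sub>8\<^sup>(\<^sup>1\<^sup>)\<close>, either there is a walk of positive gain from \<open>y\<close> to \<open>Y\<^bsub>i+2\<^esub>\<close> or \<open>Y\<^bsub>i+3\<^esub>\<close>, or
    \<open>y\<close> has a unique neighbour \<open>z\<close> outside \<open>Y\<^bsub>i-2\<^esub> \<union> {x\<^sub>i}\<close>, and \<open>y, z, w\<close> is a path with
    \<open>w \<in> Y\<^bsub>i+2\<^esub>\<close> (\<open>step_or_unique_link\<close>). If the second alternative holds for \<open>w\<close> too, then its
    unique neighbour is again \<open>z\<close>, and \<open>z\<close> joins \<open>y\<close> to \<open>Y\<^bsub>i+4\<^esub>\<close> with gain 2.
\<close>

section \<open>Induced embeddings\<close>

text \<open>An isomorphism of \<open>H\<close> onto an induced subgraph of \<open>G\<close>; values outside \<open>H\<close> are arbitrary.\<close>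

definition embeds :: "('b \<Rightarrow> 'a) \<Rightarrow> 'b pair_pre_digraph \<Rightarrow> 'a pair_pre_digraph \<Rightarrow> bool" where
  "embeds f H G \<longleftrightarrow> inj_on f (pverts H) \<and> f ` pverts H \<subseteq> pverts G \<and>
    (\<forall>a \<in> pverts H. \<forall>b \<in> pverts H. (f a, f b) \<in> parcs G \<longleftrightarrow> (a, b) \<in> parcs H)"

lemma embeds_imp_induced_in:
  assumes "pair_graph G" "pair_graph H" "embeds f H G"
  shows "H \<prec> G"
  using assms unfolding induced_in_iff[OF assms(1,2)] embeds_def by blast

text \<open>
  An embedding extends to a new leaf \<open>v\<close> attached to \<open>a\<close>, once an image \<open>p\<close> is found that is
  adjacent to the image of \<open>a\<close> and to no other vertex of the image of \<open>H\<close>.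
\<close>

lemma embeds_pendant:
  assumes G: "pair_graph G" and H: "pair_graph H" and f: "embeds f H G"
    and v: "v \<notin> pverts H" "a \<in> pverts H"
    and p: "p \<in> pverts G"
    and adj: "\<forall>h \<in> pverts H. f h \<noteq> p \<and> ((f h, p) \<in> parcs G \<longleftrightarrow> h = a)"
  shows "embeds (f(v := p)) (extend H {v} {(a, v)}) G"
proof -
  interpret G: pair_graph G by fact
  interpret H: pair_graph H by fact
  have adj': "(p, f h) \<in> parcs G \<longleftrightarrow> h = a" if "h \<in> pverts H" for h
    using adj that G.arcs_symmetric by blast
  have "p \<notin> f ` pverts H"
    using adj by blast
  moreover have noH: "(v, h) \<notin> parcs H" "(h, v) \<notin> parcs H" for h
    using v(1) H.in_arcsD1 H.in_arcsD2 by blast+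
  moreover have "(p, p) \<notin> parcs G"
    using G.no_loops' by blast
  ultimately show ?thesis
    using f v p adj adj' noH unfolding embeds_def extend_def
    by (auto simp: inj_on_def)
qed

lemma extend_extend: "extend (extend G A E) B F = extend G (A \<union> B) (E \<union> F)"
  by (auto simp: extend_def)

lemma T_eq_pendants:
  "T n = extend (extend (path_graph n) {V 3} {(U 3, V 3)}) {V' 3} {(V 3, V' 3)}"
  unfolding T_def extend_extend by (simp add: insert_commute)

lemma T8_1_eq_pendants: "T8_1 = extend (extend (T 8) {W 5} {(U 5, W 5)}) {W 6} {(U 6, W 6)}"
  unfolding T8_1_def extend_extend by (simp add: insert_commute)

lemma pverts_path_graph: "pverts (path_graph n) = U ` {1..n}"
  by (simp add: path_graph_def extend_def)

lemma pverts_T: "pverts (T n) = U ` {1..n} \<union> {V 3, V' 3}"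
  by (simp add: T_def extend_def pverts_path_graph)

section \<open>Consequences of the forbidden subgraphs and of the degree condition\<close>

lemma cycle_graph_arcs:
  "parcs (cycle_graph n) = (\<lambda>i. (i, Suc i mod n)) ` {..<n} \<union> (\<lambda>i. (Suc i mod n, i)) ` {..<n}"
  by (auto simp: cycle_graph_def extend_def)

lemma lessThan_3: "{..<3} = {0, 1, 2 :: nat}"
  by auto

lemma lessThan_4: "{..<4} = {0, 1, 2, 3 :: nat}"
  by auto

lemma C3_verts: "pverts (cycle_graph 3) = {0, 1, 2}"
  unfolding cycle_graph_def extend_def lessThan_3 by simp

lemma C3_arcs: "parcs (cycle_graph 3) = {(0, 1), (1, 2), (2, 0)} \<union> {(1, 0), (2, 1), (0, 2)}"
proof -
  have "Suc 0 mod 3 = 1" "Suc 1 mod 3 = 2" "Suc 2 mod 3 = 0"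
    by simp_all
  then show ?thesis
    unfolding cycle_graph_arcs lessThan_3 by (simp only: image_insert image_empty)
qed

lemma C4_verts: "pverts (cycle_graph 4) = {0, 1, 2, 3}"
  unfolding cycle_graph_def extend_def lessThan_4 by simp

lemma C4_arcs: "parcs (cycle_graph 4) =
  {(0, 1), (1, 2), (2, 3), (3, 0)} \<union> {(1, 0), (2, 1), (3, 2), (0, 3)}"
proof -
  have "Suc 0 mod 4 = 1" "Suc 1 mod 4 = 2" "Suc 2 mod 4 = 3" "Suc 3 mod 4 = 0"
    by simp_all
  then show ?thesis
    unfolding cycle_graph_arcs lessThan_4 by (simp only: image_insert image_empty)
qed

lemma triangle_free_if_no_induced_C3:
  assumes G: "pair_graph G" and no: "\<not> cycle_graph 3 \<prec> G"
    and arcs: "(a, b) \<in> parcs G" "(b, c) \<in> parcs G"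
  shows "(a, c) \<notin> parcs G"
proof
  interpret G: pair_graph G by fact
  assume ac: "(a, c) \<in> parcs G"
  have sym: "(b, a) \<in> parcs G" "(c, b) \<in> parcs G" "(c, a) \<in> parcs G"
    using arcs ac G.arcs_symmetric by blast+
  have verts: "a \<in> pverts G" "b \<in> pverts G" "c \<in> pverts G"
    using arcs G.in_arcsD1 G.in_arcsD2 by blast+
  have ne: "a \<noteq> b" "b \<noteq> c" "a \<noteq> c"
    using arcs ac G.no_loops' by blast+
  have loops: "(v, v) \<notin> parcs G" for v
    using G.no_loops' by blast
  define f where "f n = (if n = 0 then a else if n = 1 then b else c)" for n :: nat
  have f: "f 0 = a" "f 1 = b" "f 2 = c"
    by (simp_all add: f_def)
  have "embeds f (cycle_graph 3) G"
    unfolding embeds_def C3_verts C3_arcs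
    using arcs ac sym verts ne ne[symmetric] loops f by (simp add: inj_on_def)
  then show False
    using embeds_imp_induced_in[OF G pair_graph_cycle_graph] no by simp
qed

lemma common_neighbour_unique_if_no_induced_C4:
  assumes G: "pair_graph G" and no3: "\<not> cycle_graph 3 \<prec> G" and no4: "\<not> cycle_graph 4 \<prec> G"
    and arcs: "(a, b) \<in> parcs G" "(c, b) \<in> parcs G" "(a, d) \<in> parcs G" "(c, d) \<in> parcs G"
    and "a \<noteq> c"
  shows "b = d"
proof (rule ccontr)
  interpret G: pair_graph G by fact
  assume "b \<noteq> d"
  have sym: "(b, a) \<in> parcs G" "(b, c) \<in> parcs G" "(d, a) \<in> parcs G" "(d, c) \<in> parcs G"
    using arcs G.arcs_symmetric by blast+
  \<comment> \<open>A 4-cycle in a triangle-free graph has no chord.\<close>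
  have chords: "(a, c) \<notin> parcs G" "(c, a) \<notin> parcs G" "(b, d) \<notin> parcs G" "(d, b) \<notin> parcs G"
    using triangle_free_if_no_induced_C3[OF G no3] arcs sym by blast+
  have verts: "a \<in> pverts G" "b \<in> pverts G" "c \<in> pverts G" "d \<in> pverts G"
    using arcs G.in_arcsD1 G.in_arcsD2 by blast+
  have ne: "a \<noteq> b" "c \<noteq> b" "a \<noteq> d" "c \<noteq> d" "a \<noteq> c" "b \<noteq> d"
    using arcs G.no_loops' \<open>a \<noteq> c\<close> \<open>b \<noteq> d\<close> by blast+
  have loops: "(v, v) \<notin> parcs G" for v
    using G.no_loops' by blast
  define f where "f n = (if n = 0 then a else if n = 1 then b else if n = 2 then c else d)"
    for n :: nat
  have f: "f 0 = a" "f 1 = b" "f 2 = c" "f 3 = d"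
    by (simp_all add: f_def)
  have "embeds f (cycle_graph 4) G"
    unfolding embeds_def C4_verts C4_arcs
    using arcs sym verts ne ne[symmetric] loops chords f by (simp add: inj_on_def)
  then show False
    using embeds_imp_induced_in[OF G pair_graph_cycle_graph] no4 by simp
qed

lemma exists_third_neighbour:
  assumes G: "pair_graph G" and deg: "3 \<le> min_degree G" and v: "v \<in> pverts G"
  shows "\<exists>c. (v, c) \<in> parcs G \<and> c \<noteq> a \<and> c \<noteq> b"
proof (rule ccontr)
  interpret G: pair_graph G by fact
  assume "\<not> ?thesis"
  then have "out_arcs (with_proj G) v \<subseteq> {(v, a), (v, b)}"
    by (auto simp: out_arcs_def)
  then have "out_degree (with_proj G) v \<le> card {(v, a), (v, b)}"
    unfolding out_degree_def by (rule card_mono[rotated]) simp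
  also have "\<dots> \<le> 2"
    by (simp add: card_insert_if)
  finally have "out_degree (with_proj G) v \<le> 2" .
  moreover have "min_degree G \<le> out_degree (with_proj G) v"
    unfolding min_degree_def using v G.pair_finite_verts by (intro Min_le) auto
  ultimately show False
    using deg by simp
qed

section \<open>Geodesics realising the diameter\<close>

text \<open>Walks of length \<open>n\<close> are expressed by powers of the arc relation.\<close>

lemma gdist_le_if_relpow:
  assumes G: "pair_graph G" and u: "u \<in> pverts G" and walk: "(u, v) \<in> parcs G ^^ n"
  shows "gdist G u v \<le> ereal (real n)"
proof -
  interpret G: pair_graph G by fact
  have "\<exists>p. G.awalk u p v \<and> length p = n"
    using walk
  proof (induction n arbitrary: v)
    case 0
    then show ?case using u by (auto simp: G.awalk_Nil_iff)
  next
    case (Suc n)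
    then obtain w where w: "(u, w) \<in> parcs G ^^ n" "(w, v) \<in> parcs G"
      by auto
    obtain p where p: "G.awalk u p w" "length p = n"
      using Suc.IH[OF w(1)] by blast
    have "G.awalk w [(w, v)] v"
      using w(2) G.in_arcsD1 G.in_arcsD2 by (auto simp: G.awalk_def)
    then have "G.awalk u (p @ [(w, v)]) v"
      using p(1) by (rule G.awalk_appendI[rotated])
    then show ?case using p(2) by (intro exI[of _ "p @ [(w, v)]"]) simp
  qed
  then obtain p where p: "G.awalk u p v" "length p = n"
    by blast
  have "G.awalk_cost (\<lambda>_. 1) p = real n"
    using p(2) by (simp add: G.awalk_cost_def sum_list_triv)
  then show ?thesis
    using G.min_cost_le_walk_cost[OF p(1), of "\<lambda>_. 1"] unfolding gdist_def by simp
qed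

lemma geodesic_of_length_diam:
  assumes G: "pair_graph G" and con: "Digraph_Component.connected (with_proj G)"
    and diam: "ereal (real N) \<le> diam G"
  obtains x D where "N \<le> D" and "\<And>i. i < D \<Longrightarrow> (x i, x (Suc i)) \<in> parcs G"
    and "\<And>i j n. i \<le> D \<Longrightarrow> j \<le> D \<Longrightarrow> (x i, x j) \<in> parcs G ^^ n \<Longrightarrow> j \<le> i + n"
proof -
  interpret G: pair_graph G by fact
  let ?S = "{gdist G u v | u v. u \<in> pverts G \<and> v \<in> pverts G}"
  have "?S = (\<lambda>(u, v). gdist G u v) ` (pverts G \<times> pverts G)"
    by auto
  then have "finite ?S"
    using G.pair_finite_verts by simp
  moreover have "pverts G \<noteq> {}"
    using con by (auto simp: Digraph_Component.connected_def strongly_connected_def)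
  then have "?S \<noteq> {}"
    by blast
  ultimately have "diam G \<in> ?S"
    unfolding diam_def by (rule Max_in)
  then obtain u v where uv: "u \<in> pverts G" "v \<in> pverts G" "diam G = gdist G u v"
    by blast
  have "u \<rightarrow>\<^sup>*\<^bsub>with_proj G\<^esub> v"
    using G.symmetric_connected_imp_strongly_connected[OF G.sym_arcs con] uv
    by (auto simp: strongly_connected_def)
  then have "(u, v) \<in> (parcs G)\<^sup>*"
    unfolding reachable_def by (simp add: rtrancl_on_rtranclI)
  then obtain n0 where "(u, v) \<in> parcs G ^^ n0"
    by (meson rtrancl_imp_relpow)
  define D where "D = (LEAST n. (u, v) \<in> parcs G ^^ n)"
  have D: "(u, v) \<in> parcs G ^^ D"
    unfolding D_def using \<open>(u, v) \<in> parcs G ^^ n0\<close> by (rule LeastI)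
  have min: "D \<le> n" if "(u, v) \<in> parcs G ^^ n" for n
    unfolding D_def using that by (rule Least_le)
  have "ereal (real N) \<le> ereal (real D)"
    using gdist_le_if_relpow[OF G uv(1) D] diam uv(3) by (metis order_trans)
  then have "N \<le> D"
    by simp
  obtain x where x: "x 0 = u" "x D = v" "\<And>i. i < D \<Longrightarrow> (x i, x (Suc i)) \<in> parcs G"
    using D unfolding relpow_fun_conv by blast
  have seg: "(x i, x (i + k)) \<in> parcs G ^^ k" if "i + k \<le> D" for i k
    unfolding relpow_fun_conv using that x(3)
    by (intro exI[of _ "\<lambda>l. x (i + l)"]) auto
  show ?thesis
  proof
    show "N \<le> D" by fact
    show "(x i, x (Suc i)) \<in> parcs G" if "i < D" for i
      using that by (rule x(3))
    show "j \<le> i + n" if ij: "i \<le> D" "j \<le> D" and walk: "(x i, x j) \<in> parcs G ^^ n" for i j n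
    proof -
      have "(u, x i) \<in> parcs G ^^ i" "(x j, v) \<in> parcs G ^^ (D - j)"
        using seg[of 0 i] seg[of j "D - j"] ij x(1,2) by auto
      with walk have "(u, v) \<in> parcs G ^^ (i + (n + (D - j)))"
        unfolding relpow_add by blast
      then show ?thesis
        using min[of "i + (n + (D - j))"] ij by linarith
    qed
  qed
qed

section \<open>Neighbours of a geodesic\<close>

text \<open>
  A graph of girth at least 5 and minimum degree at least 3, with a geodesic
  \<open>x 0, \<dots>, x D\<close>. That the path is geodesic is expressed by the bound on all walks between two of
  its vertices; the bound in the other direction follows by symmetry.
\<close>

locale girth5_geodesic = pair_graph G for G :: "'a pair_pre_digraph" +
  fixes x :: "nat \<Rightarrow> 'a" and D :: nat
  assumes triangle_free: "(a, b) \<in> parcs G \<Longrightarrow> (b, c) \<in> parcs G \<Longrightarrow> (a, c) \<notin> parcs G"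
    and common_neighbour_unique: "(a, b) \<in> parcs G \<Longrightarrow> (c, b) \<in> parcs G \<Longrightarrow>
      (a, d) \<in> parcs G \<Longrightarrow> (c, d) \<in> parcs G \<Longrightarrow> a \<noteq> c \<Longrightarrow> b = d"
    and third_neighbour: "v \<in> pverts G \<Longrightarrow> \<exists>c. (v, c) \<in> parcs G \<and> c \<noteq> a \<and> c \<noteq> b"
    and x_path: "i < D \<Longrightarrow> (x i, x (Suc i)) \<in> parcs G"
    and x_geodesic: "i \<le> D \<Longrightarrow> j \<le> D \<Longrightarrow> (x i, x j) \<in> parcs G ^^ n \<Longrightarrow> j \<le> i + n"
begin

abbreviation adj :: "'a \<Rightarrow> 'a \<Rightarrow> bool" (infix \<open>\<sim>\<close> 50) where
  "a \<sim> b \<equiv> (a, b) \<in> parcs G"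

text \<open>The neighbours of \<open>x i\<close> off the geodesic.\<close>

definition Y :: "nat \<Rightarrow> 'a set" where
  "Y i = {y. x i \<sim> y \<and> y \<notin> x ` {..D}}"

lemma adj_sym: "a \<sim> b \<Longrightarrow> b \<sim> a"
  using arcs_symmetric by blast

lemma adj_relpow: "a \<sim> b \<Longrightarrow> (a, b) \<in> parcs G ^^ 1"
  by simp

lemma adj2_relpow: "a \<sim> b \<Longrightarrow> b \<sim> c \<Longrightarrow> (a, c) \<in> parcs G ^^ 2"
  by (auto simp: numeral_2_eq_2)

lemma adj_in_verts: "a \<sim> b \<Longrightarrow> a \<in> pverts G \<and> b \<in> pverts G"
  using in_arcsD1 in_arcsD2 by blast

lemma x_inj: "i \<le> D \<Longrightarrow> j \<le> D \<Longrightarrow> x i = x j \<Longrightarrow> i = j"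
  using x_geodesic[of i j 0] x_geodesic[of j i 0] by simp

lemma x_adj_iff:
  assumes "i \<le> D" "j \<le> D"
  shows "x i \<sim> x j \<longleftrightarrow> j = Suc i \<or> i = Suc j"
proof
  assume a: "x i \<sim> x j"
  then have "j \<le> i + 1" "i \<le> j + 1"
    using x_geodesic adj_relpow adj_sym assms by blast+
  moreover have "i \<noteq> j"
    using a no_loops' by blast
  ultimately show "j = Suc i \<or> i = Suc j"
    by linarith
next
  assume "j = Suc i \<or> i = Suc j"
  then show "x i \<sim> x j"
  proof
    assume "j = Suc i"
    then show ?thesis
      using x_path[of i] assms by simp
  next
    assume "i = Suc j"
    then show ?thesis
      using x_path[of j, THEN adj_sym] assms by simp
  qed
qed

lemma x_in_verts: "0 < D \<Longrightarrow> i \<le> D \<Longrightarrow> x i \<in> pverts G"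
  using x_path[of i, THEN adj_in_verts] x_path[of "i - 1", THEN adj_in_verts]
  by (cases "i < D") auto

lemma Y_adj: "y \<in> Y i \<Longrightarrow> x i \<sim> y" and Y_off: "y \<in> Y i \<Longrightarrow> j \<le> D \<Longrightarrow> y \<noteq> x j"
  by (auto simp: Y_def)

lemma Y_only_neighbour_aux:
  assumes y: "y \<in> Y i" "x j \<sim> y" and "i < j" "j \<le> D"
  shows False
proof -
  have xi: "x i \<sim> y" "y \<sim> x j"
    using y Y_adj adj_sym by blast+
  have "j \<le> i + 2"
    using x_geodesic[OF _ _ adj2_relpow[OF xi]] assms by simp
  then consider "j = Suc i" | "j = Suc (Suc i)"
    using assms by linarith
  then show False
  proof cases
    case 1
    then show ?thesis
      using triangle_free[OF xi] x_path[of i] assms by simp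
  next
    case 2
    then have "x i \<sim> x (Suc i)" "x j \<sim> x (Suc i)" "x i \<noteq> x j"
      using x_adj_iff x_inj[of i j] assms by auto
    then have "y = x (Suc i)"
      using common_neighbour_unique xi(1) y(2) by blast
    then show ?thesis
      using Y_off[OF y(1)] 2 assms by simp
  qed
qed

lemma Y_only_neighbour:
  assumes y: "y \<in> Y i" "x j \<sim> y" and "i \<le> D" "j \<le> D"
  shows "j = i"
proof -
  have "y \<in> Y j"
    using y by (simp add: Y_def)
  then show ?thesis
    using Y_only_neighbour_aux[of y i j] Y_only_neighbour_aux[of y j i] assms Y_adj
    by (metis linorder_neqE_nat)
qed

text \<open>The gain \<open>j - i - n\<close> of a walk of length \<open>n\<close> from \<open>Y i\<close> to \<open>Y j\<close> is at most 2.\<close>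

lemma Y_Y_walk_bound:
  assumes "y \<in> Y i" "y' \<in> Y j" "(y, y') \<in> parcs G ^^ n" "i \<le> D" "j \<le> D"
  shows "j \<le> i + n + 2"
proof -
  have "(x i, y) \<in> parcs G ^^ 1" "(y', x j) \<in> parcs G ^^ 1"
    using assms(1,2) Y_adj adj_sym adj_relpow by blast+
  with assms(3) have "(x i, x j) \<in> parcs G ^^ (1 + (n + 1))"
    unfolding relpow_add by blast
  then show ?thesis
    using x_geodesic[OF assms(4,5), of "1 + (n + 1)"] by simp
qed

lemma Y_Y_adj:
  assumes "y \<in> Y i" "y' \<in> Y j" "y \<sim> y'" "i \<le> D" "j \<le> D"
  shows "j \<in> {i + 2, i + 3} \<or> i \<in> {j + 2, j + 3}"
proof -
  have *: "j \<le> i + 3 \<and> j \<noteq> Suc i \<and> j \<noteq> i" if "y \<in> Y i" "y' \<in> Y j" "y \<sim> y'" "i \<le> D" "j \<le> D"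
    for y y' i j
  proof (intro conjI notI)
    show "j \<le> i + 3"
      using Y_Y_walk_bound[OF that(1,2) adj_relpow[OF that(3)] that(4,5)] by simp
  next
    assume "j = i"
    then show False
      using triangle_free[of "x i" y y'] that Y_adj by blast
  next
    assume "j = Suc i"
    then have "x i \<sim> x j"
      using x_path[of i] that by simp
    moreover have "x i \<noteq> y'"
      using Y_off that by metis
    ultimately have "y = x j"
      using common_neighbour_unique[of "x i" y y' "x j"] that Y_adj adj_sym by blast
    then show False
      using Y_off that by blast
  qed
  show ?thesis
    using *[OF assms] *[OF assms(2,1) adj_sym[OF assms(3)] assms(5,4)] by auto
qed

lemma Y_common_unique:
  assumes "y \<in> Y i" "y' \<in> Y i" "z \<sim> y" "z \<sim> y'" "z \<noteq> x i"
  shows "y = y'"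
  using common_neighbour_unique[of z y "x i" y'] assms Y_adj by blast

lemma Y_nonempty:
  assumes "0 < i" "i < D"
  obtains y where "y \<in> Y i"
proof -
  obtain c where c: "x i \<sim> c" "c \<noteq> x (Suc i)" "c \<noteq> x (i - 1)"
    using third_neighbour x_in_verts[of i] assms by (metis less_imp_le less_trans)
  have "c \<noteq> x j" if "j \<le> D" for j
  proof
    assume "c = x j"
    then have "j = Suc i \<or> i = Suc j"
      using c x_adj_iff assms that by simp
    then show False
      using c \<open>c = x j\<close> by auto
  qed
  then show ?thesis
    using that c by (auto simp: Y_def)
qed

lemma Y_neighbour_off:
  assumes "y \<in> Y i" "y \<sim> z" "z \<noteq> x i" "i \<le> D" "j \<le> D"
  shows "z \<noteq> x j"
  using Y_only_neighbour[of y i j] assms adj_sym by blast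

lemma Y_neighbour_cases:
  assumes "y \<in> Y i" "y \<sim> z" "z \<noteq> x i" "i \<le> D" "j \<le> D" "x j \<sim> z"
  shows "z \<in> Y j \<and> (j \<in> {i + 2, i + 3} \<or> i \<in> {j + 2, j + 3})"
proof -
  have "z \<in> Y j"
    using Y_neighbour_off[OF assms(1-4)] assms(6) by (auto simp: Y_def)
  then show ?thesis
    using Y_Y_adj assms by blast
qed

text \<open>
  Besides \<open>x i\<close>, the vertex \<open>y\<close> has two further neighbours, and they cannot both lie in \<open>Y j\<close>.
\<close>

lemma Y_neighbour_outside:
  assumes "y \<in> Y i" "j \<le> D"
  obtains z where "y \<sim> z" "z \<noteq> x i" "z \<notin> Y j"
proof -
  have y: "y \<in> pverts G"
    using assms Y_adj adj_in_verts by blast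
  obtain a where a: "y \<sim> a" "a \<noteq> x i"
    using third_neighbour[OF y] by blast
  obtain b where b: "y \<sim> b" "b \<noteq> x i" "b \<noteq> a"
    using third_neighbour[OF y, of "x i" a] by blast
  show ?thesis
  proof (cases "a \<in> Y j \<and> b \<in> Y j")
    case True
    then have "y = x j"
      using Y_common_unique a b by blast
    then show ?thesis
      using Y_off assms by blast
  qed (use that a b in blast)
qed

section \<open>Embedding the trees along the geodesic\<close>

text \<open>
  The map \<open>u\<^sub>k \<mapsto> x\<^bsub>i+k-3\<^esub>\<close>, which places the branch vertex \<open>u\<^sub>3\<close> at \<open>x\<^sub>i\<close>. It is used for \<open>k \<ge> 1\<close> and
  \<open>i \<ge> 2\<close> only, where the subtraction on \<open>nat\<close> is exact; the values at other kinds of vertices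
  are irrelevant.
\<close>

definition spine :: "nat \<Rightarrow> vertex \<Rightarrow> 'a" where
  "spine i v = (case v of U k \<Rightarrow> x (i + k - 3) | _ \<Rightarrow> x 0)"

lemma spine_U: "spine i (U k) = x (i + k - 3)"
  by (simp add: spine_def)

lemma path_embeds:
  assumes "0 < D" "2 \<le> i" "i + n \<le> D + 3"
  shows "embeds (spine i) (path_graph n) G"
proof -
  have arcs: "(U k, U l) \<in> parcs (path_graph n) \<longleftrightarrow> l = Suc k \<or> k = Suc l"
    if "k \<in> {1..n}" "l \<in> {1..n}" for k l
    using that by (auto simp: path_graph_def extend_def)
  have "x (i + k - 3) \<sim> x (i + l - 3) \<longleftrightarrow> l = Suc k \<or> k = Suc l"
    if "k \<in> {1..n}" "l \<in> {1..n}" for k l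
  proof -
    have "i + k - 3 \<le> D" "i + l - 3 \<le> D"
      and "(i + l - 3 = Suc (i + k - 3)) = (l = Suc k)" "(i + k - 3 = Suc (i + l - 3)) = (k = Suc l)"
      using that assms by auto
    then show ?thesis
      using x_adj_iff by simp
  qed
  moreover have "inj_on (spine i) (pverts (path_graph n))"
  proof -
    have "k = l" if "x (i + k - 3) = x (i + l - 3)" "k \<in> {1..n}" "l \<in> {1..n}" for k l
    proof -
      have "i + k - 3 \<le> D" "i + l - 3 \<le> D" "i + k - 3 = i + l - 3 \<longleftrightarrow> k = l"
        using that assms by auto
      then show ?thesis
        using x_inj that(1) by blast
    qed
    then show ?thesis
      by (auto simp: inj_on_def pverts_path_graph spine_U)
  qed
  ultimately show ?thesis
    using arcs x_in_verts assms unfolding embeds_def pverts_path_graph by (auto simp: spine_U)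
qed

lemma Y_meets_spine:
  assumes w: "w \<in> Y (i + l)" and i: "2 \<le> i" "i + n \<le> D + 3" "l + 3 \<le> n"
  shows "\<forall>k \<in> {1..n}. spine i (U k) \<noteq> w \<and> (spine i (U k) \<sim> w \<longleftrightarrow> k = l + 3)"
proof
  fix k
  assume k: "k \<in> {1..n}"
  have "i + l \<le> D" "i + k - 3 \<le> D" "i + k - 3 = i + l \<longleftrightarrow> k = l + 3"
    using i k by auto
  then show "spine i (U k) \<noteq> w \<and> (spine i (U k) \<sim> w \<longleftrightarrow> k = l + 3)"
    using Y_only_neighbour[OF w, of "i + k - 3"] Y_adj[OF w] Y_off[OF w] by (auto simp: spine_U)
qed

text \<open>
  The only vertices of the segment starting at \<open>x (i - 2)\<close> that \<open>z\<close> could be adjacent to are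
  \<open>x (i - 2)\<close>, \<open>x (i + 2)\<close> and \<open>x (i + 3)\<close>, so the last three assumptions suffice.
\<close>

lemma T_embeds:
  assumes n: "3 \<le> n" and i: "2 \<le> i" "i + n \<le> D + 3"
    and y: "y \<in> Y i" and z: "y \<sim> z" "z \<noteq> x i"
    and far: "z \<notin> Y (i - 2)" "z \<notin> Y (i + 2)" "z \<notin> Y (i + 3)"
  shows "embeds ((spine i)(V 3 := y, V' 3 := z)) (T n) G"
proof -
  have iD: "i \<le> D" "0 < D"
    using n i by auto
  have le: "i + k - 3 \<le> D" if "k \<in> {1..n}" for k
    using that i by auto
  have y_spine: "\<forall>k \<in> {1..n}. spine i (U k) \<noteq> y \<and> (spine i (U k) \<sim> y \<longleftrightarrow> k = 3)"
    using Y_meets_spine[of y i 0 n] y n i by simp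
  have z_spine: "\<forall>k \<in> {1..n}. spine i (U k) \<noteq> z \<and> \<not> spine i (U k) \<sim> z"
    unfolding spine_U
  proof (intro ballI conjI notI)
    show False if "x (i + k - 3) = z" "k \<in> {1..n}" for k
      using Y_neighbour_off[OF y z iD(1) le[OF that(2)]] that(1) by simp
  next
    fix k
    assume k: "k \<in> {1..n}"
    assume adj: "x (i + k - 3) \<sim> z"
    have *: "z \<in> Y (i + k - 3)"
      "i + k - 3 \<in> {i + 2, i + 3} \<or> i \<in> {i + k - 3 + 2, i + k - 3 + 3}"
      using Y_neighbour_cases[OF y z iD(1) le[OF k] adj] by blast+
    then have "i + k - 3 = i - 2 \<or> i + k - 3 \<in> {i + 2, i + 3}"
      using k i by auto
    then show False
      using far *(1) by auto
  qed
  have yz: "y \<in> pverts G" "z \<in> pverts G" "y \<noteq> z"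
    using z adj_in_verts no_loops' by blast+
  let ?H = "extend (path_graph n) {V 3} {(U 3, V 3)}"
  have H: "pverts ?H = insert (V 3) (U ` {1..n})"
    by (simp add: extend_def pverts_path_graph)
  have embeds_H: "embeds ((spine i)(V 3 := y)) ?H G"
    by (rule embeds_pendant[OF pair_graph_axioms pair_graph_path_graph path_embeds])
      (use n i iD yz y_spine in \<open>simp_all add: pverts_path_graph image_iff\<close>)
  have "pair_graph ?H"
    by (rule pair_graph_extend[OF pair_graph_path_graph]) (use n in \<open>auto simp: pverts_path_graph\<close>)
  moreover have "V' 3 \<notin> pverts ?H" "V 3 \<in> pverts ?H"
    by (auto simp: H)
  moreover have "\<forall>h \<in> pverts ?H. ((spine i)(V 3 := y)) h \<noteq> z \<and>
      (((spine i)(V 3 := y)) h \<sim> z \<longleftrightarrow> h = V 3)"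
    using yz(3) z(1) z_spine by (simp add: H)
  ultimately show ?thesis
    unfolding T_eq_pendants using embeds_pendant[OF pair_graph_axioms _ embeds_H] yz(2) by blast
qed

lemma T_induced:
  assumes "3 \<le> n" "2 \<le> i" "i + n \<le> D + 3" "y \<in> Y i" "y \<sim> z" "z \<noteq> x i"
    and "z \<notin> Y (i - 2)" "z \<notin> Y (i + 2)" "z \<notin> Y (i + 3)"
  shows "T n \<prec> G"
  using embeds_imp_induced_in[OF pair_graph_axioms pair_graph_T[OF assms(1)] T_embeds[OF assms]] .

lemma T8_2_induced:
  assumes i: "2 \<le> i" "i + 5 \<le> D" and y: "y \<in> Y i" and z: "y \<sim> z" "z \<noteq> x i"
    and far: "z \<notin> Y (i - 2)" "z \<notin> Y (i + 2)" "z \<notin> Y (i + 3)"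
    and w: "w \<in> Y (i + 1)" "\<not> z \<sim> w"
  shows "T8_2 \<prec> G"
proof -
  have wy: "\<not> y \<sim> w"
    using Y_Y_adj[of y i w "i + 1"] w y i by auto
  have "w \<noteq> z"
    using wy z by blast
  have "w \<in> pverts G"
    using Y_adj w(1) adj_in_verts by blast+
  have "w \<noteq> y"
    using Y_only_neighbour[OF w(1), of i] Y_adj[OF y] i by auto
  have spine: "\<forall>k \<in> {1..8}. spine i (U k) \<noteq> w \<and> (spine i (U k) \<sim> w \<longleftrightarrow> k = 4)"
    using Y_meets_spine[OF w(1) i(1), of 8] i by simp
  let ?f = "(spine i)(V 3 := y, V' 3 := z)"
  have f: "embeds ?f (T 8) G"
    using T_embeds[OF _ i(1) _ y z far, of 8] i by simp
  have "\<forall>h \<in> pverts (T 8). ?f h \<noteq> w \<and> (?f h \<sim> w \<longleftrightarrow> h = U 4)"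
    using spine wy \<open>w \<noteq> z\<close> \<open>w \<noteq> y\<close> w(2) by (auto simp: pverts_T ball_Un)
  moreover have "W 4 \<notin> pverts (T 8)" "U 4 \<in> pverts (T 8)"
    by (auto simp: pverts_T)
  ultimately have "embeds (?f(W 4 := w)) T8_2 G"
    unfolding T8_2_def
    using embeds_pendant[OF pair_graph_axioms pair_graph_T f] \<open>w \<in> pverts G\<close> by simp
  then show ?thesis
    by (rule embeds_imp_induced_in[OF pair_graph_axioms pair_graph_T8_2])
qed

lemma T8_1_induced:
  assumes i: "2 \<le> i" "i + 5 \<le> D" and y: "y \<in> Y i" and z: "y \<sim> z" "z \<noteq> x i"
    and far: "z \<notin> Y (i - 2)" "z \<notin> Y (i + 2)" "z \<notin> Y (i + 3)"
    and w: "w \<in> Y (i + 2)" "\<not> y \<sim> w" "\<not> z \<sim> w"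
    and w': "w' \<in> Y (i + 3)" "\<not> y \<sim> w'" "\<not> z \<sim> w'"
  shows "T8_1 \<prec> G"
proof -
  have ww': "\<not> w \<sim> w'"
    using Y_Y_adj[of w "i + 2" w' "i + 3"] w w' i by auto
  have disjoint: "v \<noteq> v'" if "v \<in> Y a" "v' \<in> Y b" "a \<noteq> b" "a \<le> D" "b \<le> D" for v v' a b
    using Y_only_neighbour that Y_adj by blast
  have in_G: "w \<in> pverts G" "w' \<in> pverts G"
    using Y_adj w(1) w'(1) adj_in_verts by blast+
  have ne: "w \<noteq> y" "w' \<noteq> y" "w' \<noteq> w" "w \<noteq> z" "w' \<noteq> z"
    using disjoint w(1) w'(1) y i far by auto
  have spine: "\<forall>k \<in> {1..8}. spine i (U k) \<noteq> w \<and> (spine i (U k) \<sim> w \<longleftrightarrow> k = 5)"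
    using Y_meets_spine[OF w(1) i(1), of 8] i by simp
  have spine': "\<forall>k \<in> {1..8}. spine i (U k) \<noteq> w' \<and> (spine i (U k) \<sim> w' \<longleftrightarrow> k = 6)"
    using Y_meets_spine[OF w'(1) i(1), of 8] i by simp
  let ?H = "extend (T 8) {W 5} {(U 5, W 5)}"
  have H: "pair_graph ?H"
    by (rule pair_graph_extend[OF pair_graph_T]) (auto simp: pverts_T)
  have verts_H: "pverts ?H = insert (W 5) (pverts (T 8))"
    by (simp add: extend_def)
  let ?f = "(spine i)(V 3 := y, V' 3 := z)"
  have f: "embeds ?f (T 8) G"
    using T_embeds[OF _ i(1) _ y z far, of 8] i by simp
  have "\<forall>h \<in> pverts (T 8). ?f h \<noteq> w \<and> (?f h \<sim> w \<longleftrightarrow> h = U 5)"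
    using spine w(2,3) ne by (auto simp: pverts_T ball_Un)
  moreover have "W 5 \<notin> pverts (T 8)" "U 5 \<in> pverts (T 8)"
    by (auto simp: pverts_T)
  ultimately have g: "embeds (?f(W 5 := w)) ?H G"
    using embeds_pendant[OF pair_graph_axioms pair_graph_T f] in_G(1) by simp
  have "\<forall>h \<in> pverts ?H. (?f(W 5 := w)) h \<noteq> w' \<and> ((?f(W 5 := w)) h \<sim> w' \<longleftrightarrow> h = U 6)"
    using spine' w'(2,3) ne ww' by (auto simp: verts_H pverts_T ball_Un)
  moreover have "W 6 \<notin> pverts ?H" "U 6 \<in> pverts ?H"
    by (auto simp: verts_H pverts_T)
  ultimately have "embeds (?f(W 5 := w, W 6 := w')) T8_1 G"
    unfolding T8_1_eq_pendants
    using embeds_pendant[OF pair_graph_axioms H g] in_G(2) by simp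
  then show ?thesis
    by (rule embeds_imp_induced_in[OF pair_graph_axioms pair_graph_T8_1])
qed

section \<open>The three trees in graphs of large diameter\<close>

text \<open>
  Three consecutive edges, each of gain 1 or 2, cannot start in \<open>Y 2\<close>. The hypothesis is needed only
  for \<open>i \<le> 6\<close>: the first two steps have total gain exactly 2, so both have gain 1 and they end in \<open>Y 6\<close>.
\<close>

lemma direct_steps_contradiction:
  assumes "8 < D" and step: "\<And>i y. 2 \<le> i \<Longrightarrow> i \<le> 6 \<Longrightarrow> y \<in> Y i \<Longrightarrow>
      \<exists>y'. y \<sim> y' \<and> (y' \<in> Y (i + 2) \<or> y' \<in> Y (i + 3))"
  shows False
proof -
  have step': "\<exists>j y'. (j = i + 2 \<or> j = i + 3) \<and> y' \<in> Y j \<and> y \<sim> y'"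
    if "2 \<le> i" "i \<le> 6" "y \<in> Y i" for i y
    using step[OF that] by blast
  obtain y where y: "y \<in> Y 2"
    using Y_nonempty[of 2] assms by auto
  obtain a ya where a: "a = 2 + 2 \<or> a = 2 + 3" "ya \<in> Y a" "y \<sim> ya"
    using step'[of 2 y] y by fastforce
  obtain b yb where b: "b = a + 2 \<or> b = a + 3" "yb \<in> Y b" "ya \<sim> yb"
    using step'[of a ya] a(1,2) by fastforce
  have "b \<le> 6"
    using Y_Y_walk_bound[OF y b(2) adj2_relpow[OF a(3) b(3)]] a b assms by auto
  then obtain c yc where c: "c = b + 2 \<or> c = b + 3" "yc \<in> Y c" "yb \<sim> yc"
    using step'[of b yb] a(1) b(1,2) by fastforce
  have "(y, yc) \<in> parcs G ^^ 3"
    using a(3) b(3) c(3) by (auto simp: numeral_3_eq_3)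
  then show False
    using Y_Y_walk_bound[OF y c(2), of 3] a(1) b(1) c(1) \<open>b \<le> 6\<close> assms(1) by auto
qed

theorem T9_induced_if_long:
  assumes "12 \<le> D"
  shows "T 9 \<prec> G"
proof (rule ccontr)
  assume no: "\<not> T 9 \<prec> G"
  have "\<exists>y'. y \<sim> y' \<and> (y' \<in> Y (i + 2) \<or> y' \<in> Y (i + 3))"
    if i: "2 \<le> i" "i \<le> 6" and y: "y \<in> Y i" for i y
  proof -
    obtain z where z: "y \<sim> z" "z \<noteq> x i" "z \<notin> Y (i - 2)"
      by (rule Y_neighbour_outside[OF y, of "i - 2"]) (use i assms in auto)
    then show ?thesis
      using T_induced[of 9 i y z] no i y assms by auto
  qed
  then show False
    by (rule direct_steps_contradiction[rotated]) (use assms in auto)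
qed

text \<open>
  If \<open>z\<close> has no neighbour on the geodesic, then \<open>T8_2\<close> can only be avoided by \<open>z\<close> being adjacent to
  \<open>Y (i + 1)\<close>, and then likewise to \<open>Y (i + 2)\<close>, up to \<open>Y (i + 5)\<close>, which is too far from \<open>Y i\<close>.
\<close>

lemma Y_neighbour_has_neighbour_on_geodesic:
  assumes no: "\<not> T8_2 \<prec> G" and i: "2 \<le> i" "i + 10 \<le> D" and y: "y \<in> Y i" "y \<sim> z"
  shows "\<exists>j \<le> D. x j \<sim> z"
proof (rule ccontr)
  assume "\<not> ?thesis"
  then have free: "\<not> x j \<sim> z" if "j \<le> D" for j
    using that by blast
  have z: "z \<noteq> x j" if "j < D" for j
    using free[of "Suc j"] x_path[OF that] adj_sym that by (meson Suc_leI)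
  have "\<exists>w. w \<in> Y (i + k) \<and> w \<sim> z" if "k \<le> 5" for k
    using that
  proof (induction k)
    case 0
    then show ?case using y by auto
  next
    case (Suc k)
    then obtain w where w: "w \<in> Y (i + k)" "w \<sim> z"
      by auto
    obtain w' where w': "w' \<in> Y (i + k + 1)"
      using Y_nonempty[of "i + k + 1"] i Suc.prems by auto
    have "z \<notin> Y (i + k - 2)" "z \<notin> Y (i + k + 2)" "z \<notin> Y (i + k + 3)"
      using free Y_adj Suc.prems i by force+
    then have "z \<sim> w'"
      using T8_2_induced[of "i + k" w z w'] w w' z[of "i + k"] no i Suc.prems by auto
    then show ?case
      using w' adj_sym by (metis add_Suc_right Suc_eq_plus1)
  qed
  then obtain w where w: "w \<in> Y (i + 5)" "w \<sim> z"
    by blast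
  then show False
    using Y_Y_walk_bound[OF y(1) w(1) adj2_relpow[OF y(2) adj_sym[OF w(2)]]] i by simp
qed

theorem T8_2_induced_if_long:
  assumes "16 \<le> D"
  shows "T8_2 \<prec> G"
proof (rule ccontr)
  assume no: "\<not> T8_2 \<prec> G"
  have "\<exists>y'. y \<sim> y' \<and> (y' \<in> Y (i + 2) \<or> y' \<in> Y (i + 3))"
    if i: "2 \<le> i" "i \<le> 6" and y: "y \<in> Y i" for i y
  proof -
    obtain z where z: "y \<sim> z" "z \<noteq> x i" "z \<notin> Y (i - 2)"
      by (rule Y_neighbour_outside[OF y, of "i - 2"]) (use i assms in auto)
    obtain j where j: "j \<le> D" "x j \<sim> z"
      using Y_neighbour_has_neighbour_on_geodesic[OF no i(1) _ y z(1)] i assms by auto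
    then have zj: "z \<in> Y j" "j \<in> {i + 2, i + 3} \<or> i \<in> {j + 2, j + 3}"
      using Y_neighbour_cases[OF y z(1,2) _ j] i assms by auto
    obtain w where w: "w \<in> Y (i + 1)"
      using Y_nonempty[of "i + 1"] i assms by auto
    \<comment> \<open>The case \<open>z \<in> Y (i - 3)\<close> remains; there \<open>z\<close> is too far from \<open>w\<close> to be adjacent to it.\<close>
    have "\<not> z \<sim> w" if "i = j + 3"
      using Y_Y_adj[OF zj(1) w] that i assms by auto
    then have "z \<in> Y (i + 2) \<or> z \<in> Y (i + 3)"
      using T8_2_induced[OF i(1) _ y z(1,2,3) _ _ w] zj z(3) no i assms by auto
    then show ?thesis
      using z(1) by blast
  qed
  then show False
    by (rule direct_steps_contradiction[rotated]) (use assms in auto)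
qed

text \<open>
  The alternative \<open>link\<close> is the path \<open>y, z, w\<close> of gain 0. Its vertex \<open>z\<close> is then not adjacent to the
  geodesic and is determined by \<open>y\<close>.
\<close>

lemma step_or_unique_link:
  assumes no: "\<not> T8_1 \<prec> G" and i: "2 \<le> i" "i + 5 \<le> D" and y: "y \<in> Y i"
  obtains (short) j y' m where "j = i + 2 \<or> j = i + 3" "y' \<in> Y j" "(y, y') \<in> parcs G ^^ m" "i + m < j"
  | (link) z w where "y \<sim> z" "z \<sim> w" "w \<in> Y (i + 2)" "\<And>j. j \<le> D \<Longrightarrow> \<not> x j \<sim> z"
      "\<And>z'. y \<sim> z' \<Longrightarrow> z' \<noteq> x i \<Longrightarrow> z' \<notin> Y (i - 2) \<Longrightarrow> z' = z"
proof -
  obtain w where w: "w \<in> Y (i + 2)"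
    using Y_nonempty[of "i + 2"] i by auto
  obtain w' where w': "w' \<in> Y (i + 3)"
    using Y_nonempty[of "i + 3"] i by auto
  show ?thesis
  proof (cases "\<exists>v. y \<sim> v \<and> (v \<in> Y (i + 2) \<or> v \<in> Y (i + 3) \<or> v \<sim> w')")
    case True
    then obtain v where v: "y \<sim> v" "v \<in> Y (i + 2) \<or> v \<in> Y (i + 3) \<or> v \<sim> w'"
      by blast
    have "(y, v) \<in> parcs G ^^ 1"
      using v(1) by simp
    moreover have "(y, w') \<in> parcs G ^^ 2" if "v \<sim> w'"
      using adj2_relpow[OF v(1) that] .
    ultimately show ?thesis
      using v(2) short[of "i + 2" v 1] short[of "i + 3" v 1] short[of "i + 3" w' 2] w' by auto
  next
    case False
    \<comment> \<open>All other ways of avoiding an induced copy of the tree would give a walk of positive gain.\<close>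
    have to_w: "v \<sim> w" if "y \<sim> v" "v \<noteq> x i" "v \<notin> Y (i - 2)" for v
      using T8_1_induced[OF i y that(1,2,3), of w w'] False that(1) w w' no by blast
    obtain z where z: "y \<sim> z" "z \<noteq> x i" "z \<notin> Y (i - 2)"
      by (rule Y_neighbour_outside[OF y, of "i - 2"]) (use i in auto)
    have "y \<noteq> w"
      using Y_only_neighbour[OF y, of "i + 2"] Y_adj[OF w] i by auto
    show ?thesis
    proof (rule link[OF z(1) to_w[OF z] w])
      show "\<not> x j \<sim> z" if "j \<le> D" for j
      proof
        assume "x j \<sim> z"
        then have j: "z \<in> Y j" "j \<in> {i + 2, i + 3} \<or> i \<in> {j + 2, j + 3}"
          using Y_neighbour_cases[OF y z(1,2) _ that] i by auto
        then have "i = j + 3"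
          using False z by auto
        then show False
          using Y_Y_adj[OF j(1) w to_w[OF z]] i by auto
      qed
      show "z' = z" if "y \<sim> z'" "z' \<noteq> x i" "z' \<notin> Y (i - 2)" for z'
        using common_neighbour_unique[of y z' w z] to_w[OF that] to_w[OF z] that(1) z(1)
          \<open>y \<noteq> w\<close> adj_sym by blast
    qed
  qed
qed

text \<open>A link of gain 0 is followed either by a walk of positive gain or by a link through the same \<open>z\<close>.\<close>

lemma shortening_step:
  assumes no: "\<not> T8_1 \<prec> G" and i: "2 \<le> i" "i + 7 \<le> D" and y: "y \<in> Y i"
  obtains j y' m where "j \<le> i + 5" "y' \<in> Y j" "(y, y') \<in> parcs G ^^ m" "i + m < j"
proof (cases rule: step_or_unique_link[OF no i(1) _ y, case_names bound short link])
  case bound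
  then show ?case using i by simp
next
  case (short j y' m)
  then show ?thesis
    using that[of j y' m] by auto
next
  case (link z w)
  note outer = link
  have z_off: "z \<noteq> x (i + 2)"
    using outer(4)[of "i + 1"] x_path[of "i + 1"] i by auto
  have yw: "(y, w) \<in> parcs G ^^ 2"
    using adj2_relpow link by blast
  show ?thesis
  proof (cases rule: step_or_unique_link[OF no _ _ link(3), case_names low bound short link])
    case (short j y' m)
    have "(y, y') \<in> parcs G ^^ (2 + m)"
      unfolding relpow_add using yw short(3) by blast
    then show ?thesis
      using that[of j y' "2 + m"] short by auto
  next
    case (link z' w')
    \<comment> \<open>Both are the unique neighbour of \<open>w\<close> outside \<open>Y i\<close> and other than \<open>x (i + 2)\<close>.\<close>
    have "z = z'"
      using link(5)[OF adj_sym[OF outer(2)] z_off] outer(4)[of i] Y_adj[of z i] i by auto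
    then have "(y, w') \<in> parcs G ^^ 2"
      using adj2_relpow link(2) outer(1) by blast
    then show ?thesis
      using that[OF _ link(3), of 2] by simp
  qed (use i in auto)
qed

theorem T8_1_induced_if_long:
  assumes "19 \<le> D"
  shows "T8_1 \<prec> G"
proof (rule ccontr)
  assume no: "\<not> T8_1 \<prec> G"
  obtain y where y: "y \<in> Y 2"
    using Y_nonempty[of 2] assms by auto
  obtain a ya k where a: "a \<le> 7" "ya \<in> Y a" "(y, ya) \<in> parcs G ^^ k" "2 + k < a"
    using shortening_step[OF no _ _ y] assms by auto
  obtain b yb l where b: "b \<le> a + 5" "yb \<in> Y b" "(ya, yb) \<in> parcs G ^^ l" "a + l < b"
    using shortening_step[OF no _ _ a(2)] a assms by auto
  obtain c yc m where c: "c \<le> b + 5" "yc \<in> Y c" "(yb, yc) \<in> parcs G ^^ m" "b + m < c"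
    using shortening_step[OF no _ _ b(2)] a b assms by auto
  have "(y, yc) \<in> parcs G ^^ (k + (l + m))"
    unfolding relpow_add using a(3) b(3) c(3) by blast
  then show False
    using Y_Y_walk_bound[OF y c(2), of "k + (l + m)"] a b c assms by auto
qed

end

theorem theorem1p3:
  fixes G :: "'a pair_pre_digraph"
  assumes "pair_graph G"
    and "Digraph_Component.connected (with_proj G)"
    and "\<not> cycle_graph 3 \<prec> G" and "\<not> cycle_graph 4 \<prec> G"
    and "3 \<le> min_degree G"
  shows "(20 \<le> diam G \<longrightarrow> T8_1 \<prec> G) \<and>
    (16 \<le> diam G \<longrightarrow> T8_2 \<prec> G) \<and>
    (12 \<le> diam G \<longrightarrow> T 9 \<prec> G)"
proof -
  have geodesic: "\<exists>x D. N \<le> D \<and> girth5_geodesic G x D" if diam: "ereal (real N) \<le> diam G" for N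
  proof (rule geodesic_of_length_diam[OF assms(1,2) diam])
    fix x D
    assume "N \<le> D" and path: "\<And>i. i < D \<Longrightarrow> (x i, x (Suc i)) \<in> parcs G"
      and geo: "\<And>i j n. i \<le> D \<Longrightarrow> j \<le> D \<Longrightarrow> (x i, x j) \<in> parcs G ^^ n \<Longrightarrow> j \<le> i + n"
    have "girth5_geodesic G x D"
      by (intro girth5_geodesic.intro girth5_geodesic_axioms.intro)
        (fact assms(1) triangle_free_if_no_induced_C3[OF assms(1,3)]
          common_neighbour_unique_if_no_induced_C4[OF assms(1,3,4)]
          exists_third_neighbour[OF assms(1,5)] path geo)+
    with \<open>N \<le> D\<close> show ?thesis
      by blast
  qed
  show ?thesis
  proof (intro conjI impI)
    assume "20 \<le> diam G"
    then obtain x D where "20 \<le> D" "girth5_geodesic G x D"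
      using geodesic[of 20] by auto
    then show "T8_1 \<prec> G"
      using girth5_geodesic.T8_1_induced_if_long[of G x D] by simp
  next
    assume "16 \<le> diam G"
    then obtain x D where "16 \<le> D" "girth5_geodesic G x D"
      using geodesic[of 16] by auto
    then show "T8_2 \<prec> G"
      by (rule girth5_geodesic.T8_2_induced_if_long[rotated])
  next
    assume "12 \<le> diam G"
    then obtain x D where "12 \<le> D" "girth5_geodesic G x D"
      using geodesic[of 12] by auto
    then show "T 9 \<prec> G"
      by (rule girth5_geodesic.T9_induced_if_long[rotated])
  qed
qed

end
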